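(* Let $A \in \mathbb{C}^{d\times d}$ be a known diagonalizable matrix with collision-free eigenvalues, and let $\phi \in \mathbb{C}^d$ depend on all eigenspaces of $A$. Then every $x \in \mathbb{C}^d$ can be recovered from the samples $\{|\langle x, A^\ell \phi\rangle|\}_{\ell=0}^{d^2-1}$ up to global phase; that is, if $x, x' \in \mathbb{C}^d$ satisfy $|\langle x, A^\ell\phi\rangle| = |\langle x', A^\ell\phi\rangle|$ for all $\ell = 0,\dots,d^2-1$, then $x' = e^{i\theta}x$ for some $\theta\in\mathbb{R}$.
   Context: $\langle\cdot,\cdot\rangle$ is the standard inner product on $\mathbb{C}^d$. Write $A = S\Lambda S^{-1}$ with $S$ invertible (columns are eigenvectors, not necessarily orthogonal) and $\Lambda = \mathrm{diag}(\lambda_0,\dots,\lambda_{d-1})$. The eigenvalues are called collision-free if the $d^2$ products $\lambda_j\overline{\lambda_k}$, $j,k\in\{0,\dots,d-1\}$, are pairwise distinct (for distinct ordered index pairs $(j,k)$). The vector $\phi$ depends on all eigenspaces of $A$ if every coordinate of $S^{-1}\phi$ is non-zero. *)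

theory Defs
  imports Complex_Main "Jordan_Normal_Form.Matrix"
begin

text \<open>Pairs are ordered: the products for (j, k) and (k, j) have to differ when j and k do.\<close>

definition collision_free :: "nat \<Rightarrow> (nat \<Rightarrow> complex) \<Rightarrow> bool" where
  "collision_free d ev \<longleftrightarrow>
     inj_on (\<lambda>(j, k). ev j * cnj (ev k)) ({..<d} \<times> {..<d})"

text \<open>The first argument is the inverse of the matrix whose columns are eigenvectors.\<close>

definition depends_on_all_eigenspaces :: "complex mat \<Rightarrow> complex vec \<Rightarrow> bool" where
  "depends_on_all_eigenspaces S_inv \<phi> \<longleftrightarrow>
     (\<forall>i < dim_vec (S_inv *\<^sub>v \<phi>). (S_inv *\<^sub>v \<phi>) $ i \<noteq> 0)"

end

theory Submission
  imports Defs "HOL-Computational_Algebra.Polynomial"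
begin

text \<open>
  In the eigenbasis each squared sample is a linear combination of the \<open>l\<close>-th powers of the
  \<open>d\<^sup>2\<close> products \<open>\<lambda>\<^sub>j \<lambda>\<^sub>k\<^sup>*\<close>. These nodes being distinct, the Vandermonde
  system determines its coefficients, which are the entries of a rank-one matrix \<open>b b\<^sup>*\<close>, and that
  matrix determines \<open>b\<close> up to a phase. Since no coordinate of \<open>\<phi>\<close> vanishes in the eigenbasis,
  \<open>b\<close> determines \<open>x\<close> linearly.
\<close>

text \<open>Combining the moments with the coefficients of a polynomial gives the weighted sum of
  its values at the nodes. A polynomial that vanishes at every node except \<open>z m\<close>
  isolates \<open>w m\<close>.\<close>

lemma vandermonde_kernel_trivial:
  fixes z w :: "'i \<Rightarrow> 'a::idom"
  assumes fin: "finite I" and inj: "inj_on z I"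
    and moments: "\<And>l. l < card I \<Longrightarrow> (\<Sum>i\<in>I. w i * z i ^ l) = 0"
    and m: "m \<in> I"
  shows "w m = 0"
proof -
  define p where "p = (\<Prod>i\<in>I - {m}. [:- z i, 1:])"
  have "degree p = card (I - {m})"
    unfolding p_def by (subst degree_prod_sum_eq) auto
  \<comment> \<open>Having one factor fewer than there are nodes keeps the degree within the range
    where the moments are known to vanish.\<close>
  then have deg: "degree p < card I"
    using fin m by (metis card_Diff1_less)
  have root: "poly p (z i) = 0" if "i \<in> I - {m}" for i
    unfolding p_def poly_prod using fin that by (auto intro!: prod_zero)
  have nz: "poly p (z m) \<noteq> 0"
    unfolding p_def poly_prod using fin m inj by (auto simp: inj_on_def)
  have "(\<Sum>i\<in>I. w i * poly p (z i)) = (\<Sum>l\<le>degree p. coeff p l * (\<Sum>i\<in>I. w i * z i ^ l))"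
    unfolding poly_altdef sum_distrib_left
    by (subst sum.swap) (simp add: mult_ac)
  also have "\<dots> = 0"
    using moments deg by (intro sum.neutral) auto
  finally have "(\<Sum>i\<in>I. w i * poly p (z i)) = 0" .
  moreover have "(\<Sum>i\<in>I. w i * poly p (z i)) = w m * poly p (z m)"
    using fin m root by (simp add: sum.remove)
  ultimately show ?thesis using nz by simp
qed

text \<open>One non-zero entry \<open>b m\<close> suffices: the diagonal gives \<open>b m\<close>
  and \<open>b' m\<close> equal modulus, so their quotient is the phase, and column \<open>m\<close>
  carries it to all other entries.\<close>

lemma rank_one_determines_up_to_phase:
  fixes b b' :: "'i \<Rightarrow> complex"
  assumes eq: "\<And>j k. j \<in> I \<Longrightarrow> k \<in> I \<Longrightarrow> b j * cnj (b k) = b' j * cnj (b' k)"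
  obtains u where "cmod u = 1" "\<And>j. j \<in> I \<Longrightarrow> b' j = u * b j"
proof (cases "\<exists>m\<in>I. b m \<noteq> 0")
  \<comment> \<open>The diagonal products force \<open>b'\<close> to vanish on \<open>I\<close> as
    well, so any phase would do.\<close>
  case False
  then have "b' j = 1 * b j" if "j \<in> I" for j
    using eq[OF that that] that by simp
  then show ?thesis using that[of 1] by simp
next
  case True
  then obtain m where m: "m \<in> I" "b m \<noteq> 0" by blast
  have "(cmod (b m))\<^sup>2 = (cmod (b' m))\<^sup>2"
    using eq[OF m(1) m(1)] unfolding complex_norm_square[symmetric] by (metis of_real_eq_iff)
  then have "cmod (b m) = cmod (b' m)" by simp
  then have norm: "cmod (b' m / b m) = 1"
    using m by (metis divide_self norm_divide norm_eq_zero)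
  have "b' m \<noteq> 0" using norm by auto
  \<comment> \<open>Column \<open>m\<close> relates \<open>b' j\<close> to \<open>b j\<close>; the
    diagonal equation then trades the squared modulus of \<open>b m\<close> for that of
    \<open>b' m\<close>, so that \<open>cnj (b' m)\<close> can be cancelled.\<close>
  moreover have "b' j * cnj (b' m) = (b' m / b m * b j) * cnj (b' m)" if "j \<in> I" for j
  proof -
    have "b' j * cnj (b' m) * b m = b j * (b m * cnj (b m))"
      using eq[OF that m(1)] by (simp add: mult_ac)
    also have "\<dots> = b j * (b' m * cnj (b' m))"
      using eq[OF m(1) m(1)] by simp
    finally show ?thesis using m(2) by (simp add: field_simps)
  qed
  ultimately have "b' j = b' m / b m * b j" if "j \<in> I" for j
    using that by (metis complex_cnj_zero_iff mult_right_cancel)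
  then show ?thesis using norm that by blast
qed

text \<open>Lifting: squaring makes the phaseless sample linear in the entries of the rank-one
  matrix, with the products from \<open>collision_free\<close> as nodes.\<close>

lemma cmod_power_sum_squared:
  fixes b z :: "nat \<Rightarrow> complex"
  shows "of_real ((cmod (\<Sum>j<n. b j * z j ^ l))\<^sup>2) =
    (\<Sum>(j, k)\<in>{..<n} \<times> {..<n}. b j * cnj (b k) * (z j * cnj (z k)) ^ l)"
  unfolding complex_norm_square
  by (simp add: sum_product sum.cartesian_product power_mult_distrib mult_ac)

lemma phase_retrieval_power_sums:
  fixes b b' z :: "nat \<Rightarrow> complex"
  assumes cf: "collision_free n z"
    and eq: "\<And>l. l < n\<^sup>2 \<Longrightarrow> cmod (\<Sum>j<n. b j * z j ^ l) = cmod (\<Sum>j<n. b' j * z j ^ l)"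
  shows "\<exists>u. cmod u = 1 \<and> (\<forall>j<n. b' j = u * b j)"
proof -
  let ?I = "{..<n} \<times> {..<n}"
  \<comment> \<open>By linearity, equal samples say that the difference of the two rank-one matrices
    has vanishing moments.\<close>
  define w where "w = (\<lambda>(j, k). b j * cnj (b k) - b' j * cnj (b' k))"
  have "w i = 0" if "i \<in> ?I" for i
  proof (rule vandermonde_kernel_trivial[OF _ cf[unfolded collision_free_def] _ that])
    fix l assume "l < card ?I"
    then have "l < n\<^sup>2" by (simp add: power2_eq_square)
    have "(\<Sum>i\<in>?I. w i * (case i of (j, k) \<Rightarrow> z j * cnj (z k)) ^ l) =
        of_real ((cmod (\<Sum>j<n. b j * z j ^ l))\<^sup>2) - of_real ((cmod (\<Sum>j<n. b' j * z j ^ l))\<^sup>2)"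
      unfolding cmod_power_sum_squared w_def
      by (simp add: sum_subtractf[symmetric] case_prod_unfold left_diff_distrib)
    then show "(\<Sum>i\<in>?I. w i * (case i of (j, k) \<Rightarrow> z j * cnj (z k)) ^ l) = 0"
      using eq[OF \<open>l < n\<^sup>2\<close>] by simp
  qed simp
  then have "b j * cnj (b k) = b' j * cnj (b' k)" if "j \<in> {..<n}" "k \<in> {..<n}" for j k
    using that by (fastforce simp: w_def)
  then show ?thesis
    using rank_one_determines_up_to_phase[of "{..<n}" b b'] by (metis lessThan_iff)
qed

lemma mat_diag_pow:
  fixes f :: "nat \<Rightarrow> 'a::comm_semiring_1"
  shows "mat_diag n f ^\<^sub>m l = mat_diag n (\<lambda>i. f i ^ l)"
proof (induction l)
  case 0
  then show ?case by (simp add: mat_diag_def)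
next
  case (Suc l)
  then show ?case by (simp add: mult.commute)
qed

lemma mat_diag_mult_vec_index:
  fixes f :: "nat \<Rightarrow> 'a::comm_semiring_1"
  assumes "v \<in> carrier_vec n" "i < n"
  shows "(mat_diag n f *\<^sub>v v) $ i = f i * v $ i"
proof -
  have "(mat_diag n f *\<^sub>v v) $ i = (\<Sum>j\<in>{0..<n}. (if i = j then f j else 0) * v $ j)"
    using assms by (simp add: mat_diag_def scalar_prod_def)
  also have "\<dots> = (\<Sum>j\<in>{0..<n}. if j = i then f i * v $ i else 0)"
    by (intro sum.cong) auto
  finally show ?thesis using assms by simp
qed

text \<open>Since \<open>\<bullet>c\<close> conjugates its second argument, this moves the
  conjugation off the powers of \<open>A\<close>, so that eigenvalues enter the samples
  unconjugated.\<close>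

lemma cmod_cscalar_prod_conjugate:
  fixes v w :: "complex vec"
  assumes "v \<in> carrier_vec n" "w \<in> carrier_vec n"
  shows "cmod (v \<bullet>c w) = cmod (conjugate v \<bullet> w)"
  using conjugate_conjugate_sprod[OF assms] by (metis complex_mod_cnj conjugate_complex_def)

text \<open>Powers of \<open>A\<close> act diagonally between \<open>S\<close> and
  \<open>S_inv\<close>. The product is bilinear here, so \<open>S\<close> crosses it as a transpose
  rather than an adjoint.\<close>

lemma diagonalized_sample:
  fixes A :: "complex mat"
  assumes A: "A \<in> carrier_mat n n" and wit: "similar_mat_wit A (mat_diag n ev) S S_inv"
    and \<phi>: "\<phi> \<in> carrier_vec n" and v: "v \<in> carrier_vec n"
  shows "v \<bullet> (A ^\<^sub>m l *\<^sub>v \<phi>) =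
    (\<Sum>j<n. ((transpose_mat S *\<^sub>v v) $ j * (S_inv *\<^sub>v \<phi>) $ j) * ev j ^ l)"
proof -
  note W = similar_mat_witD2[OF A wit]
  let ?D = "mat_diag n (\<lambda>i. ev i ^ l)"
  let ?c = "S_inv *\<^sub>v \<phi>"
  have c: "?c \<in> carrier_vec n" using W \<phi> by simp
  have Dc: "?D *\<^sub>v ?c \<in> carrier_vec n" using mult_mat_vec_carrier[OF mat_diag_dim c] .
  have "A ^\<^sub>m l *\<^sub>v \<phi> = S *\<^sub>v (?D *\<^sub>v ?c)"
    using W \<phi> similar_mat_wit_pow_id[OF wit, of l]
    by (simp add: mat_diag_pow assoc_mult_mat_vec[where n\<^sub>1 = n and n\<^sub>2 = n and n\<^sub>3 = n])
  then have "v \<bullet> (A ^\<^sub>m l *\<^sub>v \<phi>) = (transpose_mat S *\<^sub>v v) \<bullet> (?D *\<^sub>v ?c)"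
    using transpose_vec_mult_scalar[OF W(6) Dc v] by simp
  also have "\<dots> = (\<Sum>j<n. (transpose_mat S *\<^sub>v v) $ j * (ev j ^ l * ?c $ j))"
    unfolding scalar_prod_def using Dc c
    by (intro sum.cong) (auto simp del: index_mult_mat_vec simp: mat_diag_mult_vec_index carrier_matD(1)[OF mat_diag_dim])
  finally show ?thesis by (simp only: mult_ac)
qed

theorem theorem4p1:
  fixes d :: nat
    and A S S_inv :: "complex mat"
    and ev :: "nat \<Rightarrow> complex"
    and \<phi> x x' :: "complex vec"
  assumes "A \<in> carrier_mat d d"
    and "similar_mat_wit A (mat_diag d ev) S S_inv"
    and "collision_free d ev"
    and "\<phi> \<in> carrier_vec d"
    and "depends_on_all_eigenspaces S_inv \<phi>"
    and "x \<in> carrier_vec d"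
    and "x' \<in> carrier_vec d"
    and "\<forall>l < d^2. cmod (x \<bullet>c (A ^\<^sub>m l *\<^sub>v \<phi>)) = cmod (x' \<bullet>c (A ^\<^sub>m l *\<^sub>v \<phi>))"
  shows "\<exists>\<theta> :: real. x' = exp (\<i> * complex_of_real \<theta>) \<cdot>\<^sub>v x"
proof -
  note W = similar_mat_witD2[OF assms(1,2)]
  let ?y = "transpose_mat S *\<^sub>v conjugate x"
  let ?y' = "transpose_mat S *\<^sub>v conjugate x'"
  let ?c = "S_inv *\<^sub>v \<phi>"
  have cx: "conjugate x \<in> carrier_vec d" "conjugate x' \<in> carrier_vec d"
    using assms by auto
  have pow: "A ^\<^sub>m l *\<^sub>v \<phi> \<in> carrier_vec d" for l
    using assms(1,4) by (meson mult_mat_vec_carrier pow_carrier_mat)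
  have samples: "cmod (\<Sum>j<d. (?y $ j * ?c $ j) * ev j ^ l) = cmod (\<Sum>j<d. (?y' $ j * ?c $ j) * ev j ^ l)"
    if "l < d\<^sup>2" for l
    unfolding diagonalized_sample[OF assms(1,2,4) cx(1), symmetric]
      diagonalized_sample[OF assms(1,2,4) cx(2), symmetric]
    using assms(8) that cmod_cscalar_prod_conjugate[OF assms(6) pow]
      cmod_cscalar_prod_conjugate[OF assms(7) pow] by simp
  obtain u where u: "cmod u = 1" and b: "\<forall>j<d. ?y' $ j * ?c $ j = u * (?y $ j * ?c $ j)"
    using phase_retrieval_power_sums[OF assms(3) samples] by blast
  \<comment> \<open>The dependence on all eigenspaces allows the factor contributed by
    \<open>\<phi>\<close> to be cancelled in each coordinate.\<close>
  have "?c $ j \<noteq> 0" if "j < d" for j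
    using assms(5) W(7) that
    by (simp add: depends_on_all_eigenspaces_def del: index_mult_mat_vec)
  then have y: "?y' $ j = u * ?y $ j" if "j < d" for j
    using b that by (metis mult.assoc mult_right_cancel)
  have y': "?y' = u \<cdot>\<^sub>v ?y"
    using W(6) y by (intro eq_vecI) (auto simp del: index_mult_mat_vec)
  \<comment> \<open>Transposing \<open>S * S_inv = 1\<close> gives a left inverse of
    \<open>transpose_mat S\<close>, which recovers the conjugated signals from \<open>?y\<close> and
    \<open>?y'\<close>.\<close>
  have inv: "transpose_mat S_inv *\<^sub>v (transpose_mat S *\<^sub>v v) = v" if "v \<in> carrier_vec d" for v
  proof -
    have "transpose_mat S_inv *\<^sub>v (transpose_mat S *\<^sub>v v) =
        (transpose_mat S_inv * transpose_mat S) *\<^sub>v v"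
      using W that by (intro assoc_mult_mat_vec[symmetric]) auto
    also have "\<dots> = v"
      unfolding transpose_mult[OF W(6,7), symmetric] W(1) using that by simp
    finally show ?thesis .
  qed
  have yc: "?y \<in> carrier_vec d" using W cx by simp
  have "conjugate x' = transpose_mat S_inv *\<^sub>v (u \<cdot>\<^sub>v ?y)"
    using inv[OF cx(2)] y' by simp
  also have "\<dots> = u \<cdot>\<^sub>v (transpose_mat S_inv *\<^sub>v ?y)"
    using W yc by (intro mult_mat_vec) auto
  also have "\<dots> = u \<cdot>\<^sub>v conjugate x" using inv[OF cx(1)] by simp
  \<comment> \<open>Undoing the conjugation turns the phase \<open>u\<close> into
    \<open>cnj u\<close>, which is still unimodular.\<close>
  finally have "conjugate (conjugate x') = conjugate (u \<cdot>\<^sub>v conjugate x)" by simp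
  then have x': "x' = cnj u \<cdot>\<^sub>v x" by (simp add: conjugate_smult_vec)
  have "cmod (cnj u) = 1" using u by simp
  then obtain \<theta> where "cnj u = Complex (cos \<theta>) (sin \<theta>)" by (rule complex_unimodular_polar)
  then have "cnj u = exp (\<i> * complex_of_real \<theta>)"
    by (simp add: cis_conv_exp[symmetric] complex_eq_iff)
  then show ?thesis using x' by (intro exI[of _ \<theta>]) simp
qed

end
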